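(* Let $T=T(r,s)$ be a tree with bipartition classes $R$ and $S$ such that $|R|=r\le s=|S|$. (1) If $r=1$, then $\mathrm{ex}(m,n;T(1,s))=(s-1)m$. (2) If $r\ge 2$, let $m$ and $n$ be positive integers satisfying $n\ge s(m-r+2)\binom{m}{r-1}$. Then $$\mathrm{ex}(m,n;T(r,s))\;\le\;(r-1)\,n+C(m,r,s),$$ where $$C(m,r,s)=\binom{m}{r-1}^2(s-1)+m\left\lfloor\frac{m}{r-1}\right\rfloor s+ms(m-r+2)\binom{m}{r-1}.$$
   Context: All graphs are finite, simple and undirected. For a graph $H$ and positive integers $m\le n$, $\mathrm{ex}(m,n;H)$ is the maximum number of edges in an $H$-free bipartite graph $G=(A,B;E)$ with parts $A,B$ of sizes $|A|=m$ and $|B|=n$. Here "$H$-free" means that $G$ contains no (not necessarily induced) subgraph isomorphic to $H$; a copy of $H$ may be placed in $G$ with either orientation with respect to the parts $A,B$. A tree $T$ is bipartite; $T=T(r,s)$ indicates that its two bipartition classes $R,S$ have sizes $r$ and $s$ with $r\le s$.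
   Formalization: Part (1) is stated with the extra condition s-1 ≤ n; without it the claim is false (if m ≤ n < s-1, then K_{m,n} contains no T(1,s), so ex(m,n;T(1,s)) = mn < (s-1)m). *)

theory Defs
  imports Complex_Main
begin

type_synonym 'a graph = "'a set \<times> 'a set set"

abbreviation verts :: "'a graph \<Rightarrow> 'a set" where "verts \<equiv> fst"
abbreviation edges :: "'a graph \<Rightarrow> 'a set set" where "edges \<equiv> snd"

definition simple_graph :: "'a graph \<Rightarrow> bool" where
  "simple_graph G \<longleftrightarrow> finite (verts G) \<and> (\<forall>e\<in>edges G. e \<subseteq> verts G \<and> card e = 2)"

definition connected_graph :: "'a graph \<Rightarrow> bool" where
  "connected_graph G \<longleftrightarrow> verts G \<noteq> {} \<and>
     (\<forall>u\<in>verts G. \<forall>v\<in>verts G. (u, v) \<in> {(x, y). {x, y} \<in> edges G}\<^sup>*)"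

definition graph_cycle :: "'a graph \<Rightarrow> 'a list \<Rightarrow> bool" where
  "graph_cycle G c \<longleftrightarrow> length c \<ge> 3 \<and> distinct c \<and> set c \<subseteq> verts G \<and>
     (\<forall>i<length c. {c ! i, c ! (Suc i mod length c)} \<in> edges G)"

definition tree :: "'a graph \<Rightarrow> bool" where
  "tree T \<longleftrightarrow> simple_graph T \<and> connected_graph T \<and> (\<nexists>c. graph_cycle T c)"

definition bipartition :: "'a graph \<Rightarrow> 'a set \<Rightarrow> 'a set \<Rightarrow> bool" where
  "bipartition G A B \<longleftrightarrow> verts G = A \<union> B \<and> A \<inter> B = {} \<and>
     (\<forall>e\<in>edges G. \<exists>a\<in>A. \<exists>b\<in>B. e = {a, b})"

(* The embedding is not required to respect any bipartition of G or H, so in a bipartite G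
   a copy of H may lie in either orientation; nor need the copy be induced. *)
definition contains_copy :: "'a graph \<Rightarrow> 'b graph \<Rightarrow> bool" where
  "contains_copy G H \<longleftrightarrow>
     (\<exists>f. inj_on f (verts H) \<and> f ` verts H \<subseteq> verts G \<and> (\<forall>e\<in>edges H. f ` e \<in> edges G))"

(* Every finite graph is isomorphic to one with vertices in nat, so that vertex type loses nothing.
   The set of edge counts is bounded by m * n, and it is nonempty as soon as H has an edge
   (take G edgeless). *)
definition bip_ex :: "nat \<Rightarrow> nat \<Rightarrow> 'a graph \<Rightarrow> nat" where
  "bip_ex m n H = Max {card (edges G) | (G :: nat graph) A B.
     simple_graph G \<and> bipartition G A B \<and> card A = m \<and> card B = n \<and> \<not> contains_copy G H}"

(* Integer-valued: m - r + 2 is an untruncated difference. For naturals, div is the floor of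
   the quotient. *)
definition C_bound :: "nat \<Rightarrow> nat \<Rightarrow> nat \<Rightarrow> int" where
  "C_bound m r s =
     int (m choose (r - 1)) ^ 2 * (int s - 1)
     + int m * int (m div (r - 1)) * int s
     + int m * int s * (int m - int r + 2) * int (m choose (r - 1))"

end

theory Submission
  imports Defs
begin

text \<open>
  For \<open>r \<ge> 2\<close>, the ends of a longest path of \<open>T\<close> provide some \<open>v \<in> R\<close> all of whose neighbours,
  except possibly one, are leaves. Suppose that \<open>X \<subseteq> A\<close> has \<open>r - 1\<close> elements and at least \<open>s\<close> common
  neighbours, and that some \<open>a \<in> A - X\<close> of degree at least \<open>s\<close> is adjacent to one of them. Then \<open>T\<close>
  embeds, with \<open>v\<close> sent to \<open>a\<close>, the rest of \<open>R\<close> to \<open>X\<close>, and the leaves at \<open>v\<close> to further neighbours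
  of \<open>a\<close>. So in a \<open>T\<close>-free graph, once the at most \<open>m (s - 1)\<close> edges at vertices of \<open>A\<close> of degree
  below \<open>s\<close> are discarded, every vertex of \<open>B\<close> with at least \<open>r\<close> neighbours contains in its
  neighbourhood only \<open>(r - 1)\<close>-sets with fewer than \<open>s\<close> common neighbours; hence there are at most
  \<open>(s - 1) (m choose (r - 1))\<close> such vertices.
\<close>

section \<open>Neighbourhoods and degree sums in bipartite graphs\<close>

definition nbrs :: "'a graph \<Rightarrow> 'a \<Rightarrow> 'a set" where
  "nbrs G v = {u. {v, u} \<in> edges G}"

lemma bipartition_edgeE:
  assumes "bipartition G A B" "e \<in> edges G"
  obtains a b where "a \<in> A" "b \<in> B" "e = {a, b}"
  using assms that unfolding bipartition_def by metis

lemma mem_nbrs_commute: "u \<in> nbrs G v \<longleftrightarrow> v \<in> nbrs G u"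
  by (simp add: nbrs_def insert_commute)

lemma nbrs_bipartition:
  assumes "bipartition G A B" "u \<in> nbrs G v"
  shows "v \<in> A \<and> u \<in> B \<or> v \<in> B \<and> u \<in> A"
proof -
  have "{v, u} \<in> edges G" using assms(2) by (simp add: nbrs_def)
  then obtain a b where "a \<in> A" "b \<in> B" "{v, u} = {a, b}"
    by (rule bipartition_edgeE[OF assms(1)])
  then show ?thesis by (auto simp: doubleton_eq_iff)
qed

lemma nbrs_subset_right:
  assumes "bipartition G A B" "a \<in> A"
  shows "nbrs G a \<subseteq> B"
  using nbrs_bipartition[OF assms(1)] assms unfolding bipartition_def by blast

lemma bipartition_finite:
  assumes "simple_graph G" "bipartition G A B"
  shows "finite A" "finite B"
  using assms by (auto simp: simple_graph_def bipartition_def)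

lemma card_edges_eq:
  assumes "bipartition G A B" "finite A" "finite B"
  shows "card (edges G) = (\<Sum>a\<in>A. card (nbrs G a))"
proof -
  let ?P = "SIGMA a:A. nbrs G a"
  have sub: "nbrs G a \<subseteq> B" if "a \<in> A" for a
    using nbrs_subset_right assms(1) that .
  have disj: "A \<inter> B = {}" using assms(1) by (simp add: bipartition_def)
  have "edges G = (\<lambda>(a, b). {a, b}) ` ?P"
  proof
    show "edges G \<subseteq> (\<lambda>(a, b). {a, b}) ` ?P"
    proof
      fix e assume e: "e \<in> edges G"
      then obtain a b where "a \<in> A" "e = {a, b}"
        by (rule bipartition_edgeE[OF assms(1)])
      with e show "e \<in> (\<lambda>(a, b). {a, b}) ` ?P"
        by (auto simp: nbrs_def intro!: image_eqI[of _ _ "(a, b)"])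
    qed
  qed (auto simp: nbrs_def)
  \<comment> \<open>As \<open>A\<close> and \<open>B\<close> are disjoint, an edge determines which
    of its ends lies in \<open>A\<close>, so edges correspond to pairs and can be counted by degrees
    on one side.\<close>
  moreover have "inj_on (\<lambda>(a, b). {a, b}) ?P"
    using sub disj by (fastforce simp: inj_on_def doubleton_eq_iff)
  ultimately have "card (edges G) = card ?P" by (simp add: card_image)
  also have "\<dots> = (\<Sum>a\<in>A. card (nbrs G a))"
    using assms sub by (intro card_SigmaI) (auto intro: finite_subset)
  finally show ?thesis .
qed

lemma card_edges_le:
  assumes "simple_graph G" "bipartition G A B"
    and "\<And>a. a \<in> A \<Longrightarrow> card (nbrs G a) \<le> d"
  shows "card (edges G) \<le> card A * d"
proof -
  have "card (edges G) = (\<Sum>a\<in>A. card (nbrs G a))"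
    using card_edges_eq assms(2) bipartition_finite[OF assms(1,2)] .
  also have "\<dots> \<le> card A * d"
    using sum_bounded_above[of A "\<lambda>a. card (nbrs G a)" d] assms(3) by simp
  finally show ?thesis .
qed

lemma card_edges_le_mult:
  assumes "simple_graph G" "bipartition G A B"
  shows "card (edges G) \<le> card A * card B"
  using assms nbrs_subset_right[OF assms(2)] bipartition_finite(2)[OF assms]
  by (intro card_edges_le[OF assms]) (simp add: card_mono)

section \<open>The extremal number as a maximum\<close>

abbreviation free_edge_counts :: "nat \<Rightarrow> nat \<Rightarrow> 'a graph \<Rightarrow> nat set" where
  "free_edge_counts m n H \<equiv> {card (edges G) | (G :: nat graph) A B.
     simple_graph G \<and> bipartition G A B \<and> card A = m \<and> card B = n \<and> \<not> contains_copy G H}"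

lemma finite_free_edge_counts: "finite (free_edge_counts m n H)"
proof (rule finite_subset)
  show "free_edge_counts m n H \<subseteq> {..m * n}"
    using card_edges_le_mult by fastforce
qed simp

lemma free_edge_counts_nonempty:
  assumes "edges H \<noteq> {}"
  shows "free_edge_counts m n H \<noteq> {}"
proof -
  let ?G = "({..<m} \<union> {m..<m + n}, {}) :: nat graph"
  have "simple_graph ?G" "bipartition ?G {..<m} {m..<m + n}" "\<not> contains_copy ?G H"
    using assms by (auto simp: simple_graph_def bipartition_def contains_copy_def)
  then have "card (edges ?G) \<in> free_edge_counts m n H" by fastforce
  then show ?thesis by blast
qed

text \<open>\<open>Max\<close> is meaningful only on a nonempty finite set. An edge in
  \<open>H\<close> secures this, since edgeless graphs are then \<open>H\<close>-free.\<close>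

lemma bip_ex_le:
  assumes "edges H \<noteq> {}"
    and "\<And>(G :: nat graph) A B. \<lbrakk>simple_graph G; bipartition G A B; card A = m; card B = n;
      \<not> contains_copy G H\<rbrakk> \<Longrightarrow> card (edges G) \<le> k"
  shows "bip_ex m n H \<le> k"
  unfolding bip_ex_def
  using finite_free_edge_counts free_edge_counts_nonempty[OF assms(1)] assms(2)
  by (subst Max_le_iff) blast+

lemma bip_ex_ge:
  fixes G :: "nat graph"
  assumes "simple_graph G" "bipartition G A B" "card A = m" "card B = n" "\<not> contains_copy G H"
  shows "card (edges G) \<le> bip_ex m n H"
  unfolding bip_ex_def
  using finite_free_edge_counts by (rule Max_ge) (use assms in blast)

section \<open>Longest paths\<close>

text \<open>Paths are lists of distinct vertices. The empty list counts as a path, so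
  \<open>tl\<close> and \<open>take\<close> always give paths again.\<close>

definition path :: "'a graph \<Rightarrow> 'a list \<Rightarrow> bool" where
  "path G p \<longleftrightarrow> distinct p \<and> set p \<subseteq> verts G \<and>
     (\<forall>i. Suc i < length p \<longrightarrow> {p ! i, p ! Suc i} \<in> edges G)"

lemma path_Cons:
  assumes "path G p" "p \<noteq> []" "x \<in> verts G" "x \<notin> set p" "{x, p ! 0} \<in> edges G"
  shows "path G (x # p)"
  using assms unfolding path_def by (auto simp: nth_Cons split: nat.split)

lemma path_tl: "path G p \<Longrightarrow> path G (tl p)"
  unfolding path_def by (auto simp: distinct_tl nth_tl) (metis list.sel(2) list.set_sel(2) subsetD)

lemma path_take: "path G p \<Longrightarrow> path G (take k p)"
  unfolding path_def by (auto dest: in_set_takeD)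

text \<open>The chord from the first vertex to position \<open>i\<close> closes the initial segment;
  \<open>2 \<le> i\<close> gives the cycle its required length of at least 3.\<close>

lemma path_close_cycle:
  assumes "path G p" "i < length p" "2 \<le> i" "{p ! 0, p ! i} \<in> edges G"
  shows "graph_cycle G (take (Suc i) p)"
proof -
  let ?c = "take (Suc i) p"
  have len: "length ?c = Suc i" using assms by simp
  have pc: "path G ?c" using assms(1) by (rule path_take)
  have "{?c ! j, ?c ! (Suc j mod length ?c)} \<in> edges G" if "j < length ?c" for j
  proof (cases "j = i")
    case True
    then show ?thesis using assms len by (simp add: insert_commute)
  next
    case False
    then have "Suc j < length ?c" using that len by simp
    then show ?thesis using pc unfolding path_def by simp
  qed
  then show ?thesis
    using pc len assms(3) unfolding graph_cycle_def path_def by auto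
qed

text \<open>A neighbour of the first vertex off the path would extend the path, and one at position
  2 or later would close a cycle. Only position 1 remains.\<close>

lemma longest_path_end:
  assumes sg: "simple_graph G" and acyc: "\<nexists>c. graph_cycle G c"
    and p: "path G p" "2 \<le> length p" and mx: "\<And>q. path G q \<Longrightarrow> length q \<le> length p"
    and x: "x \<in> nbrs G (p ! 0)"
  shows "x = p ! 1"
proof -
  have e: "{p ! 0, x} \<in> edges G" using x by (simp add: nbrs_def)
  have xv: "x \<in> verts G" "x \<noteq> p ! 0" using e sg by (force simp: simple_graph_def)+
  have "x \<in> set p"
  proof (rule ccontr)
    assume "x \<notin> set p"
    then have "path G (x # p)"
      using p e xv by (intro path_Cons) (auto simp: insert_commute)
    then show False using mx by fastforce
  qed
  then obtain i where i: "i < length p" "x = p ! i" by (auto simp: in_set_conv_nth)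
  have "\<not> 2 \<le> i" using path_close_cycle[OF p(1) i(1)] e i acyc by blast
  moreover have "i \<noteq> 0" using xv(2) i(2) by metis
  ultimately have "i = 1" by simp
  then show ?thesis using i by simp
qed

lemma exists_longest_path:
  assumes "simple_graph G" "edges G \<noteq> {}"
  obtains p where "path G p" "2 \<le> length p" "\<And>q. path G q \<Longrightarrow> length q \<le> length p"
proof -
  obtain e where e: "e \<in> edges G" using assms(2) by blast
  then obtain x y where xy: "e = {x, y}" "x \<noteq> y" "e \<subseteq> verts G"
    using assms(1) unfolding simple_graph_def by (metis card_2_iff)
  have p0: "path G [x, y]" using e xy by (auto simp: path_def)
  have bound: "length q < Suc (card (verts G))" if "path G q" for q
    using that assms(1) unfolding path_def simple_graph_def
    by (metis card_mono distinct_card le_imp_less_Suc)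
  obtain p where p: "path G p" "\<And>q. path G q \<Longrightarrow> length q \<le> length p"
    using ex_has_greatest_nat[of "path G" "[x, y]" length "Suc (card (verts G))"] p0 bound
    by blast
  then show ?thesis using that p(2)[OF p0] by simp
qed

text \<open>Of the first two vertices of a longest path, one lies in \<open>R\<close>. If it is the
  end \<open>p ! 0\<close>, its only neighbour serves as \<open>w\<close> and nothing is left to
  check. If it is \<open>p ! 1\<close>, any neighbour off the path can replace \<open>p ! 0\<close>
  as the end of a longest path and so is a leaf.\<close>

lemma acyclic_penultimate:
  assumes sg: "simple_graph T" and acyc: "\<nexists>c. graph_cycle T c" and ne: "edges T \<noteq> {}"
    and bip: "bipartition T R S"
  obtains v w where "v \<in> R" "w \<in> S"
    "\<And>l x. \<lbrakk>l \<in> nbrs T v; l \<noteq> w; x \<in> nbrs T l\<rbrakk> \<Longrightarrow> x = v"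
proof -
  obtain p where p: "path T p" "2 \<le> length p" "\<And>q. path T q \<Longrightarrow> length q \<le> length p"
    using exists_longest_path[OF sg ne] by blast
  note fin = longest_path_end[OF sg acyc]
  have step: "p ! Suc i \<in> nbrs T (p ! i)" if "Suc i < length p" for i
    using p(1) that by (simp add: path_def nbrs_def)
  have s01: "p ! 1 \<in> nbrs T (p ! 0)" using step[of 0] p(2) by simp
  show ?thesis
  proof (cases "p ! 0 \<in> R")
    case True
    then have "p ! 1 \<in> S"
      using nbrs_subset_right[OF bip] s01 by blast
    then show ?thesis using that[OF True] fin[OF p] by blast
  next
    case False
    then have v: "p ! 1 \<in> R" and p0: "p ! 0 \<in> S"
      using nbrs_bipartition[OF bip s01] by blast+
    \<comment> \<open>The exceptional neighbour of \<open>p ! 1\<close> is the next vertex of the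
      path. On a path with two vertices there is none, and \<open>p ! 0\<close> stands in so that
      \<open>w\<close> is still in \<open>S\<close>.\<close>
    define w where "w = (if 3 \<le> length p then p ! 2 else p ! 0)"
    have w: "w \<in> S"
    proof (cases "3 \<le> length p")
      case True
      then show ?thesis using step[of 1] nbrs_subset_right[OF bip v]
        by (auto simp: w_def numeral_2_eq_2)
    qed (simp add: w_def p0)
    have "x = p ! 1" if l: "l \<in> nbrs T (p ! 1)" "l \<noteq> w" "x \<in> nbrs T l" for l x
    proof (cases "l = p ! 0")
      case True
      then show ?thesis using fin[OF p] l(3) by simp
    next
      case l0: False
      have e: "{p ! 1, l} \<in> edges T" using l(1) by (simp add: nbrs_def)
      have lv: "l \<in> verts T" "l \<noteq> p ! 1" using e sg by (force simp: simple_graph_def)+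
      have t: "path T (tl p)" "tl p ! 0 = p ! 1" "tl p \<noteq> []"
        using p(2) path_tl[OF p(1)] by (auto simp: nth_tl simp flip: length_greater_0_conv)
      \<comment> \<open>Positions 0, 1 and 2 are ruled out by \<open>l0\<close>, by the absence of
        loops and by the choice of \<open>w\<close>. A position from 3 on closes a cycle with
        \<open>p ! 1\<close>, the head of \<open>tl p\<close>.\<close>
      have "l \<notin> set p"
      proof
        assume "l \<in> set p"
        then obtain i where i: "i < length p" "l = p ! i" by (auto simp: in_set_conv_nth)
        have "i \<noteq> 0" "i \<noteq> 1" using i(2) l0 lv(2) by metis+
        moreover have "i \<noteq> 2" using i l(2) by (auto simp: w_def)
        ultimately have i3: "3 \<le> i" by simp
        then have "tl p ! (i - 1) = l" "i - 1 < length (tl p)"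
          using i by (auto simp: nth_tl)
        then show False
          using path_close_cycle[OF t(1), of "i - 1"] t(2) e acyc i3 by fastforce
      qed
      then have "l \<notin> set (tl p)" by (metis list.sel(2) list.set_sel(2))
      \<comment> \<open>Exchanging \<open>p ! 0\<close> for \<open>l\<close> keeps the length, so
        this path is longest too and \<open>fin\<close> applies to its end \<open>l\<close>.\<close>
      then have q: "path T (l # tl p)"
        using t lv e by (intro path_Cons) (auto simp: insert_commute)
      have "length (l # tl p) = length p" using p(2) by simp
      then show ?thesis
        using fin[OF q, of x] p(2,3) l(3) t(2) by simp
    qed
    then show ?thesis using that[OF v w] by blast
  qed
qed

section \<open>Embedding the tree\<close>

text \<open>Two injections, one per side, glue to an embedding because the parts of \<open>G\<close>
  are disjoint. Only the orientation with \<open>R\<close> inside \<open>A\<close> is ever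
  constructed.\<close>

lemma contains_copyI:
  assumes T: "bipartition T R S" and G: "bipartition G A B"
    and f: "inj_on f R" "f ` R \<subseteq> A" and g: "inj_on g S" "g ` S \<subseteq> B"
    and fg: "\<And>x y. \<lbrakk>x \<in> R; y \<in> S; {x, y} \<in> edges T\<rbrakk> \<Longrightarrow> {f x, g y} \<in> edges G"
  shows "contains_copy G T"
proof -
  define h where "h x = (if x \<in> R then f x else g x)" for x
  have disj: "R \<inter> S = {}" "A \<inter> B = {}" using T G by (auto simp: bipartition_def)
  have hR: "h x = f x" if "x \<in> R" for x using that by (simp add: h_def)
  have hS: "h x = g x" if "x \<in> S" for x using that disj by (auto simp: h_def)
  have "inj_on h (R \<union> S)"
  proof (rule inj_onI)
    fix x y assume "x \<in> R \<union> S" "y \<in> R \<union> S" "h x = h y"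
    then show "x = y"
      using f g disj hR hS by (auto dest: inj_onD) (metis disjoint_iff image_subset_iff)+
  qed
  moreover have "h ` (R \<union> S) \<subseteq> A \<union> B" using hR hS f g by auto
  moreover have "h ` e \<in> edges G" if e: "e \<in> edges T" for e
  proof -
    obtain x y where "x \<in> R" "y \<in> S" "e = {x, y}"
      by (rule bipartition_edgeE[OF T e])
    then show ?thesis using fg e hR hS by simp
  qed
  ultimately show ?thesis
    using T G unfolding contains_copy_def bipartition_def by metis
qed

text \<open>The vertex \<open>w\<close> goes to \<open>b\<close>, which is adjacent both to
  \<open>a\<close> and to all of \<open>X\<close>. A leaf in \<open>L\<close> needs only an edge to
  \<open>a\<close>; every other vertex of \<open>S\<close> needs edges only to \<open>X\<close> and
  may go anywhere in \<open>Y\<close>.\<close>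

lemma embed_penultimate:
  assumes T: "simple_graph T" "bipartition T R S"
    and vw: "v \<in> R" "w \<in> S" "\<And>l x. \<lbrakk>l \<in> nbrs T v; l \<noteq> w; x \<in> nbrs T l\<rbrakk> \<Longrightarrow> x = v"
    and G: "simple_graph G" "bipartition G A B"
    and X: "X \<subseteq> A" "card X = card R - 1" and Y: "Y \<subseteq> B" "card S \<le> card Y"
    and XY: "\<And>x y. \<lbrakk>x \<in> X; y \<in> Y\<rbrakk> \<Longrightarrow> y \<in> nbrs G x"
    and a: "a \<in> A - X" "card S \<le> card (nbrs G a)" "b \<in> nbrs G a \<inter> Y"
  shows "contains_copy G T"
proof -
  note fin = bipartition_finite[OF T] bipartition_finite[OF G]
  have na: "nbrs G a \<subseteq> B" using nbrs_subset_right[OF G(2)] a by blast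
  have finY: "finite Y" "finite (nbrs G a)" "finite X"
    using Y X na fin by (auto intro: finite_subset)
  define L where "L = nbrs T v - {w}"
  have LS: "L \<subseteq> S - {w}" using nbrs_subset_right[OF T(2) vw(1)] by (auto simp: L_def)
  have finL: "finite L" using LS fin by (auto intro: finite_subset)
  have cS: "card (S - {w}) = card S - 1" using vw by simp
  have cL: "card L \<le> card S - 1" using card_mono[OF _ LS] fin cS by simp

  have "card (R - {v}) = card X" using vw X by simp
  then obtain f0 where f0: "bij_betw f0 (R - {v}) X"
    using finite_same_card_bij finY fin by blast
  \<comment> \<open>Reserving \<open>b\<close> costs one vertex, and \<open>w\<close> is not in
    \<open>L\<close>, so the remaining neighbours of \<open>a\<close> suffice for the
    leaves.\<close>
  have "card L \<le> card (nbrs G a - {b})" using cL a finY by simp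
  then obtain g1 where g1: "g1 ` L \<subseteq> nbrs G a - {b}" "inj_on g1 L"
    using card_le_inj[OF finL] finY by blast
  \<comment> \<open>The leaf images may fall into \<open>Y\<close>, but they occupy at most
    \<open>card L\<close> vertices of \<open>Y - {b}\<close>, which has at least
    \<open>card S - 1\<close>.\<close>
  have "card (S - {w} - L) = card S - 1 - card L"
    using card_Diff_subset[OF finL LS] cS by simp
  also have "\<dots> \<le> card (Y - {b}) - card (g1 ` L)"
    using Y a finY card_image[OF g1(2)] by simp
  also have "\<dots> \<le> card (Y - {b} - g1 ` L)"
    using finL by (intro diff_card_le_card_Diff) simp
  finally obtain g2 where g2: "g2 ` (S - {w} - L) \<subseteq> Y - {b} - g1 ` L"
      "inj_on g2 (S - {w} - L)"
    using card_le_inj[of "S - {w} - L" "Y - {b} - g1 ` L"] finY fin by blast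

  define f where "f = f0(v := a)"
  define g where "g y = (if y = w then b else if y \<in> L then g1 y else g2 y)" for y
  show ?thesis
  proof (rule contains_copyI[OF T(2) G(2), of f g])
    show "inj_on f R"
      using f0 a by (auto simp: f_def inj_on_def bij_betw_def)
    show "f ` R \<subseteq> A"
      using f0 a X by (auto simp: f_def bij_betw_def)
    show "g ` S \<subseteq> B"
      using g1 g2 a Y na by (auto simp: g_def)
    show "inj_on g S"
    proof (rule inj_onI)
      fix x y assume "x \<in> S" "y \<in> S" "g x = g y"
      then show "x = y"
        using g1 g2 by (auto simp: g_def split: if_splits dest: inj_onD)
    qed
    fix x y assume xy: "x \<in> R" "y \<in> S" "{x, y} \<in> edges T"
    then have nx: "y \<in> nbrs T x" by (simp add: nbrs_def)
    have "g y \<in> nbrs G (f x)"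
    proof (cases "x = v")
      case True
      then have "g y \<in> nbrs G a" using nx g1 a by (auto simp: g_def L_def)
      then show ?thesis using True by (simp add: f_def)
    next
      case False
      \<comment> \<open>A vertex of \<open>L\<close> has \<open>v\<close> as its only neighbour,
        whereas \<open>x\<close> differs from \<open>v\<close>.\<close>
      then have "y \<notin> L"
        using vw(3)[of y x] nx by (auto simp: L_def mem_nbrs_commute)
      then have "g y \<in> Y" using g2 a xy by (auto simp: g_def)
      moreover have "f x \<in> X" using False xy f0 by (auto simp: f_def bij_betw_def)
      ultimately show ?thesis using XY by blast
    qed
    then show "{f x, g y} \<in> edges G" by (simp add: nbrs_def)
  qed
qed

section \<open>Counting edges\<close>

lemma card_edges_free_le:
  assumes T: "simple_graph T" "\<nexists>c. graph_cycle T c" "edges T \<noteq> {}" "bipartition T R S"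
    and r: "card R = r" "1 \<le> r" and s: "card S = s"
    and G: "simple_graph G" "bipartition G A B" "\<not> contains_copy G T"
    and A: "r \<le> card A"
  shows "card (edges G) \<le> card A * (s - 1) + (r - 1) * card B
           + (card A - (r - 1)) * ((s - 1) * (card A choose (r - 1)))"
proof -
  obtain v w where vw: "v \<in> R" "w \<in> S"
      "\<And>l x. \<lbrakk>l \<in> nbrs T v; l \<noteq> w; x \<in> nbrs T l\<rbrakk> \<Longrightarrow> x = v"
    using acyclic_penultimate[OF T] by blast
  have fin: "finite A" "finite B" using bipartition_finite[OF G(1,2)] .
  \<comment> \<open>\<open>big\<close> holds the vertices of \<open>A\<close> with enough neighbours
    to serve as \<open>a\<close> in the embedding. \<open>B1\<close> collects the vertices of
    \<open>B\<close> that see at least \<open>r\<close> of them.\<close>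
  define big where "big = {a \<in> A. s \<le> card (nbrs G a)}"
  define N where "N b = nbrs G b \<inter> big" for b
  define B1 where "B1 = {b \<in> B. r \<le> card (N b)}"
  define F where "F = {X. X \<subseteq> A \<and> card X = r - 1}"
  have NA: "N b \<subseteq> A" "finite (N b)" for b
    using fin by (auto simp: N_def big_def intro: finite_subset)
  have bigA: "big \<subseteq> A" "finite big" using fin by (auto simp: big_def)

  have common: "card {b \<in> B1. X \<subseteq> N b} \<le> s - 1" if X: "X \<in> F" for X
  proof (rule ccontr)
    assume "\<not> ?thesis"
    then have c: "s \<le> card {b \<in> B1. X \<subseteq> N b}" "{b \<in> B1. X \<subseteq> N b} \<noteq> {}"
      by (simp, fastforce)
    then obtain b where b: "b \<in> B1" "X \<subseteq> N b" by blast
    \<comment> \<open>\<open>X\<close> has only \<open>r - 1\<close> elements, so \<open>b\<close>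
      has a further neighbour \<open>a\<close> in \<open>big\<close>; this pair feeds the
      embedding.\<close>
    have "card X < card (N b)" using b X r by (auto simp: B1_def F_def)
    then obtain a where a: "a \<in> N b" "a \<notin> X"
      using X fin by (metis F_def card_mono finite_subset linorder_not_le mem_Collect_eq subsetI)
    have "contains_copy G T"
    proof (rule embed_penultimate[OF T(1,4) vw G(1,2),
          where X = X and Y = "{b \<in> B1. X \<subseteq> N b}" and a = a and b = b])
      show "X \<subseteq> A" "card X = card R - 1" using X r by (auto simp: F_def)
      show "{b \<in> B1. X \<subseteq> N b} \<subseteq> B" by (auto simp: B1_def)
      show "card S \<le> card {b \<in> B1. X \<subseteq> N b}" using c s by simp
      show "a \<in> A - X" "card S \<le> card (nbrs G a)" "b \<in> nbrs G a \<inter> {b \<in> B1. X \<subseteq> N b}"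
        using a b s by (auto simp: N_def big_def mem_nbrs_commute)
    qed (auto simp: N_def mem_nbrs_commute)
    then show False using G(3) by blast
  qed
  have finF: "finite F" "card F = card A choose (r - 1)"
    using fin n_subsets[of A "r - 1"] by (auto simp: F_def)
  \<comment> \<open>Union bound: each vertex of \<open>B1\<close> is charged to some
    \<open>(r - 1)\<close>-subset of its neighbourhood in \<open>big\<close>, and
    \<open>common\<close> limits the charges to each subset.\<close>
  have "B1 \<subseteq> (\<Union>X\<in>F. {b \<in> B1. X \<subseteq> N b})"
  proof
    fix b assume b: "b \<in> B1"
    then have "r - 1 \<le> card (N b)" by (simp add: B1_def le_diff_conv)
    then obtain X where "X \<subseteq> N b" "card X = r - 1" by (meson obtain_subset_with_card_n)
    then show "b \<in> (\<Union>X\<in>F. {b \<in> B1. X \<subseteq> N b})" using NA b by (auto simp: F_def)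
  qed
  then have "card B1 \<le> card (\<Union>X\<in>F. {b \<in> B1. X \<subseteq> N b})"
    using fin finF by (intro card_mono) (auto simp: B1_def)
  also have "\<dots> \<le> (\<Sum>X\<in>F. card {b \<in> B1. X \<subseteq> N b})"
    by (rule card_UN_le[OF finF(1)])
  also have "\<dots> \<le> (s - 1) * (card A choose (r - 1))"
    using sum_bounded_above[of F "\<lambda>X. card {b \<in> B1. X \<subseteq> N b}" "s - 1"] common finF
    by (simp add: mult.commute)
  finally have B1: "card B1 \<le> (s - 1) * (card A choose (r - 1))" .

  have nB: "nbrs G a \<subseteq> B" if "a \<in> A" for a
    using nbrs_subset_right G(2) that .
  \<comment> \<open>The edges at \<open>big\<close> are counted again from their ends in
    \<open>B\<close>.\<close>
  have "(\<Sum>a\<in>big. card (nbrs G a)) = (\<Sum>a\<in>big. card {b \<in> B. a \<in> nbrs G b})"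
  proof (rule sum.cong[OF refl])
    fix a assume "a \<in> big"
    then have "{b \<in> B. a \<in> nbrs G b} = nbrs G a"
      using nB bigA by (auto simp: mem_nbrs_commute)
    then show "card (nbrs G a) = card {b \<in> B. a \<in> nbrs G b}" by simp
  qed
  also have "\<dots> = (\<Sum>b\<in>B. card {a \<in> big. a \<in> nbrs G b})"
    using sum_multicount_gen[OF bigA(2) fin(2), of "\<lambda>a b. a \<in> nbrs G b"
      "\<lambda>b. card {a \<in> big. a \<in> nbrs G b}"] by simp
  also have "\<dots> = (\<Sum>b\<in>B. card (N b))"
    by (rule sum.cong) (auto simp: N_def intro!: arg_cong[of _ _ card])
  \<comment> \<open>Outside \<open>B1\<close> a vertex contributes at most \<open>r - 1\<close>;
    inside it contributes at most \<open>card A\<close>, written as \<open>r - 1\<close> plus an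
    excess. The difference is not truncated since \<open>r \<le> card A\<close>.\<close>
  also have "\<dots> \<le> (\<Sum>b\<in>B. (r - 1) + (if b \<in> B1 then card A - (r - 1) else 0))"
  proof (rule sum_mono)
    fix b assume "b \<in> B"
    moreover have "card (N b) \<le> card A" using card_mono[OF fin(1) NA(1)] .
    ultimately show "card (N b) \<le> (r - 1) + (if b \<in> B1 then card A - (r - 1) else 0)"
      using A by (auto simp: B1_def)
  qed
  also have "\<dots> = (r - 1) * card B + (card A - (r - 1)) * card B1"
  proof -
    have "B \<inter> B1 = B1" by (auto simp: B1_def)
    then show ?thesis
      using fin by (simp add: sum.distrib sum.If_cases Collect_mem_eq)
  qed
  also have "\<dots> \<le> (r - 1) * card B
      + (card A - (r - 1)) * ((s - 1) * (card A choose (r - 1)))"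
    using B1 by simp
  finally have heavy: "(\<Sum>a\<in>big. card (nbrs G a)) \<le> \<dots>" .

  have "card (nbrs G a) \<le> s - 1" if "a \<in> A - big" for a
    using that by (auto simp: big_def)
  then have "(\<Sum>a\<in>A - big. card (nbrs G a)) \<le> card (A - big) * (s - 1)"
    using sum_bounded_above[of "A - big" "\<lambda>a. card (nbrs G a)" "s - 1"] by simp
  also have "\<dots> \<le> card A * (s - 1)"
    using fin by (simp add: card_mono)
  finally have "(\<Sum>a\<in>A - big. card (nbrs G a)) \<le> card A * (s - 1)" .
  moreover have "card (edges G) = (\<Sum>a\<in>A - big. card (nbrs G a)) + (\<Sum>a\<in>big. card (nbrs G a))"
    using card_edges_eq[OF G(2) fin] sum.subset_diff[OF bigA(1) fin(1)] by metis
  ultimately show ?thesis using heavy by linarith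
qed

text \<open>The last summand of \<open>C_bound\<close> suffices. Its factor \<open>m - r + 2\<close>
  splits as \<open>1 + (m - (r - 1))\<close>: the 1 pays for \<open>m * (s - 1)\<close>, the rest
  for the other term. The remaining summands are nonnegative.\<close>

lemma C_bound_ge:
  assumes "2 \<le> r" "r \<le> m" "1 \<le> s"
  shows "int (m * (s - 1) + (m - (r - 1)) * ((s - 1) * (m choose (r - 1)))) \<le> C_bound m r s"
proof -
  let ?k = "m choose (r - 1)"
  have k: "1 \<le> ?k" using assms by (simp add: Suc_leI)
  have "m * (s - 1) \<le> m * s * ?k"
    using k by (metis diff_le_self mult.right_neutral mult_le_mono mult_le_mono2 order.trans)
  moreover have "(m - (r - 1)) * ((s - 1) * ?k) \<le> m * s * (m - (r - 1)) * ?k"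
  proof -
    have "s - 1 \<le> m * s" using assms by (intro le_trans[OF diff_le_self]) simp
    then have "(m - (r - 1)) * ?k * (s - 1) \<le> (m - (r - 1)) * ?k * (m * s)"
      by (rule mult_le_mono2)
    then show ?thesis by (simp only: ac_simps)
  qed
  ultimately have "m * (s - 1) + (m - (r - 1)) * ((s - 1) * ?k)
      \<le> m * s * (m - (r - 1) + 1) * ?k"
    unfolding add_mult_distrib add_mult_distrib2 by linarith
  then have "int (m * (s - 1) + (m - (r - 1)) * ((s - 1) * ?k))
      \<le> int (m * s * (m - (r - 1) + 1) * ?k)" by (simp only: of_nat_le_iff)
  also have "\<dots> = int m * int s * (int m - int r + 2) * int ?k"
  proof -
    have "int (m - (r - 1) + 1) = int m - int r + 2" using assms by linarith
    then show ?thesis by (simp only: of_nat_mult)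
  qed
  also have "\<dots> \<le> C_bound m r s" using assms by (simp add: C_bound_def)
  finally show ?thesis .
qed

text \<open>The integer factor \<open>m - r + 2\<close> can be negative only when
  \<open>m < r - 1\<close>, and then the binomial coefficient vanishes. For \<open>m = r - 1\<close>
  the factor is 1.\<close>

lemma C_bound_nonneg:
  assumes "m < r" "1 \<le> r" "1 \<le> s"
  shows "0 \<le> C_bound m r s"
proof (cases "m < r - 1")
  case False
  then have "r = Suc m" using assms by simp
  then show ?thesis using assms by (simp add: C_bound_def)
qed (simp add: C_bound_def binomial_eq_0)

section \<open>Stars\<close>

lemma connected_nbrs_nonempty:
  assumes "connected_graph G" "u \<in> verts G" "v \<in> verts G" "u \<noteq> v"
  obtains x where "x \<in> nbrs G u"
proof -
  have "(u, v) \<in> {(x, y). {x, y} \<in> edges G}\<^sup>*"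
    using assms by (simp add: connected_graph_def)
  then show ?thesis
    using assms(4) that by (cases rule: converse_rtranclE) (auto simp: nbrs_def)
qed

lemma star_copy:
  assumes T: "simple_graph T" "bipartition T {c} S"
    and G: "simple_graph G" "bipartition G A B"
    and a: "a \<in> A" "card S \<le> card (nbrs G a)"
  shows "contains_copy G T"
proof -
  have na: "nbrs G a \<subseteq> B" using nbrs_subset_right G(2) a(1) .
  then have "finite (nbrs G a)" using bipartition_finite[OF G] by (auto intro: finite_subset)
  then obtain g where "g ` S \<subseteq> nbrs G a" "inj_on g S"
    using card_le_inj[OF bipartition_finite(2)[OF T]] a(2) by blast
  then show ?thesis
    using a na by (intro contains_copyI[OF T(2) G(2), of "\<lambda>_. a" g]) (auto simp: nbrs_def)
qed

text \<open>The image of the centre would have at least \<open>card S\<close> neighbours. The degree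
  bound covers all vertices because the centre may land in either part.\<close>

lemma star_free:
  assumes T: "S \<noteq> {}" "nbrs T c = S" "bipartition T {c} S"
    and deg: "\<And>v. v \<in> verts G \<Longrightarrow> finite (nbrs G v) \<and> card (nbrs G v) < card S"
  shows "\<not> contains_copy G T"
proof
  assume "contains_copy G T"
  then obtain f where f: "inj_on f (verts T)" "f ` verts T \<subseteq> verts G"
      "\<And>e. e \<in> edges T \<Longrightarrow> f ` e \<in> edges G"
    unfolding contains_copy_def by blast
  have V: "verts T = {c} \<union> S" using T(3) by (simp add: bipartition_def)
  have "f ` S \<subseteq> nbrs G (f c)"
  proof
    fix y assume "y \<in> f ` S"
    then obtain x where x: "x \<in> S" "y = f x" by blast
    then have "{c, x} \<in> edges T" using T(2) by (auto simp: nbrs_def)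
    then show "y \<in> nbrs G (f c)" using f(3) x by (fastforce simp: nbrs_def)
  qed
  moreover have "card (f ` S) = card S"
    using f(1) V by (intro card_image) (auto intro: inj_on_subset)
  moreover have "f c \<in> verts G" using f(2) V by auto
  ultimately show False using deg[of "f c"] card_mono by (metis linorder_not_le)
qed

text \<open>Each left vertex \<open>i\<close> is joined to \<open>d\<close> cyclically consecutive
  right vertices, starting at \<open>i\<close>. The right part is a copy of the residues modulo
  \<open>n\<close>, shifted by \<open>m\<close> to be disjoint from the left part.\<close>

definition circulant :: "nat \<Rightarrow> nat \<Rightarrow> nat \<Rightarrow> nat graph" where
  "circulant m n d = ({..<m} \<union> {m..<m + n}, (\<lambda>(i, j). {i, m + (i + j) mod n}) ` ({..<m} \<times> {..<d}))"

lemma circulant_bipartition: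
  assumes "0 < n"
  shows "simple_graph (circulant m n d)" "bipartition (circulant m n d) {..<m} {m..<m + n}"
proof -
  show "bipartition (circulant m n d) {..<m} {m..<m + n}"
    using assms by (fastforce simp: bipartition_def circulant_def)
  show "simple_graph (circulant m n d)"
    using assms by (auto simp: simple_graph_def circulant_def card_insert_if)
qed

lemma circulant_nbrs_left:
  assumes "i < m"
  shows "nbrs (circulant m n d) i = (\<lambda>j. m + (i + j) mod n) ` {..<d}"
  using assms by (auto simp: nbrs_def circulant_def doubleton_eq_iff image_iff)

text \<open>From \<open>k = (i + j) mod n\<close> the left end is recovered as \<open>k - j\<close>
  modulo \<open>n\<close>, since \<open>i < m \<le> n\<close>. Adding \<open>n\<close> first
  prevents truncation, as \<open>j < d \<le> n\<close>. So right degrees are at most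
  \<open>d\<close> too.\<close>

lemma circulant_nbrs_right:
  assumes "m \<le> n" "d \<le> n"
  shows "nbrs (circulant m n d) (m + k) \<subseteq> (\<lambda>j. (k + n - j) mod n) ` {..<d}"
proof
  fix i assume "i \<in> nbrs (circulant m n d) (m + k)"
  then obtain j where j: "i < m" "j < d" "k = (i + j) mod n"
    by (auto simp: nbrs_def circulant_def doubleton_eq_iff)
  have "(k + n - j) mod n = i"
  proof (cases "i + j < n")
    case True
    then show ?thesis using j assms by simp
  next
    case False
    then have "k = i + j - n"
      using j assms by (simp add: mod_if)
    then show ?thesis using False j assms by simp
  qed
  then show "i \<in> (\<lambda>j. (k + n - j) mod n) ` {..<d}" using j by force
qed

lemma circulant_degree_le:
  assumes "m \<le> n" "d \<le> n" "v \<in> verts (circulant m n d)"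
  shows "finite (nbrs (circulant m n d) v) \<and> card (nbrs (circulant m n d) v) \<le> d"
proof (cases "v < m")
  case True
  then show ?thesis
    using card_image_le[of "{..<d}"] by (simp add: circulant_nbrs_left)
next
  case False
  then obtain k where "v = m + k" by (metis le_Suc_ex linorder_not_less)
  then have "nbrs (circulant m n d) v \<subseteq> (\<lambda>j. (k + n - j) mod n) ` {..<d}"
    using circulant_nbrs_right assms by blast
  then show ?thesis
    by (metis card_lessThan finite_imageI finite_lessThan finite_subset surj_card_le)
qed

lemma card_edges_circulant:
  assumes "0 < n" "d \<le> n"
  shows "card (edges (circulant m n d)) = d * m"
proof -
  have "card (nbrs (circulant m n d) i) = d" if "i \<in> {..<m}" for i
  proof -
    have "inj_on (\<lambda>j. m + (i + j) mod n) {..<d}"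
    proof (rule inj_onI)
      fix j k assume jk: "j \<in> {..<d}" "k \<in> {..<d}" "m + (i + j) mod n = m + (i + k) mod n"
      \<comment> \<open>Two offsets below \<open>d \<le> n\<close> with the same residue differ by a
        multiple of \<open>n\<close> smaller than \<open>n\<close>, hence agree.\<close>
      then have "n dvd nat \<bar>int j - int k\<bar>"
        by (simp add: mod_eq_iff_dvd_symdiff_nat)
      moreover have "nat \<bar>int j - int k\<bar> < n" using jk assms by auto
      ultimately have "nat \<bar>int j - int k\<bar> = 0" by (meson dvd_imp_le linorder_not_le neq0_conv)
      then show "j = k" by simp
    qed
    then show ?thesis using that by (simp add: circulant_nbrs_left card_image)
  qed
  then show ?thesis
    using card_edges_eq[OF circulant_bipartition(2)[OF assms(1)]] by simp
qed

text \<open>A left vertex of degree \<open>card S\<close> would be the centre of a copy, which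
  bounds the edges from above. The circulant with \<open>d = card S - 1\<close> attains the bound;
  \<open>card S - 1 \<le> n\<close> leaves room for these degrees.\<close>

lemma bip_ex_star:
  assumes T: "simple_graph T" "bipartition T {c} S" "nbrs T c = S" "S \<noteq> {}"
    and "0 < m" "m \<le> n" "card S - 1 \<le> n"
  shows "bip_ex m n T = (card S - 1) * m"
proof (rule antisym)
  have S: "0 < card S" using bipartition_finite[OF T(1,2)] T(4) by (simp add: card_gt_0_iff)
  show "bip_ex m n T \<le> (card S - 1) * m"
  proof (rule bip_ex_le)
    show "edges T \<noteq> {}" using T(3,4) by (auto simp: nbrs_def)
    fix G :: "nat graph" and A B
    assume G: "simple_graph G" "bipartition G A B" "card A = m" "\<not> contains_copy G T"
    have "card (nbrs G a) \<le> card S - 1" if "a \<in> A" for a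
      using star_copy[OF T(1,2) G(1,2) that] G(4) by linarith
    then show "card (edges G) \<le> (card S - 1) * m"
      using card_edges_le[OF G(1,2)] G(3) by (metis mult.commute)
  qed
  have "\<not> contains_copy (circulant m n (card S - 1)) T"
    using circulant_degree_le[OF assms(6,7)] S by (intro star_free[OF T(4,3,2)]) fastforce
  then have "card (edges (circulant m n (card S - 1))) \<le> bip_ex m n T"
    using assms by (intro bip_ex_ge[OF circulant_bipartition]) simp_all
  then show "(card S - 1) * m \<le> bip_ex m n T"
    using card_edges_circulant assms by simp
qed

section \<open>Combining the star case with the case \<open>r \<ge> 2\<close>\<close>

theorem theorem1p2:
  fixes T :: "'a graph" and R S :: "'a set" and r s m n :: nat
  assumes "tree T" and "bipartition T R S"
    and "card R = r" and "card S = s" and "1 \<le> r" and "r \<le> s"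
    and "0 < m" and "m \<le> n"
  shows "(r = 1 \<and> s - 1 \<le> n \<longrightarrow> bip_ex m n T = (s - 1) * m) \<and>
    (2 \<le> r \<and> int n \<ge> int s * (int m - int r + 2) * int (m choose (r - 1)) \<longrightarrow>
       int (bip_ex m n T) \<le> (int r - 1) * int n + C_bound m r s)"
proof -
  have T: "simple_graph T" "connected_graph T" "\<nexists>c. graph_cycle T c"
    using assms(1) by (auto simp: tree_def)
  note bip = assms(2)
  have "R \<noteq> {}" "S \<noteq> {}" using assms by auto
  then obtain c d where cd: "c \<in> R" "d \<in> S" by blast
  have V: "verts T = R \<union> S" "R \<inter> S = {}" using bip by (auto simp: bipartition_def)
  obtain x where "x \<in> nbrs T c"
    using connected_nbrs_nonempty[OF T(2), of c d] cd V by blast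
  then have ne: "edges T \<noteq> {}" by (auto simp: nbrs_def)
  have "bip_ex m n T = (s - 1) * m" if r: "r = 1" "s - 1 \<le> n"
  proof -
    have R: "R = {c}" using r assms(3) cd by (metis card_1_singletonE singletonD)
    \<comment> \<open>By connectivity each vertex of \<open>S\<close> has a neighbour, which can
      only be \<open>c\<close>; so \<open>T\<close> is a full star.\<close>
    have "S \<subseteq> nbrs T c"
    proof
      fix l assume l: "l \<in> S"
      then obtain y where y: "y \<in> nbrs T l"
        using connected_nbrs_nonempty[OF T(2), of l c] cd V by blast
      then have "y = c" using nbrs_bipartition[OF bip y] l V R by blast
      then show "l \<in> nbrs T c" using y by (simp add: mem_nbrs_commute)
    qed
    then have "nbrs T c = S" using nbrs_subset_right[OF bip cd(1)] by blast
    then show ?thesis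
      using bip_ex_star[of T c S m n] T bip R \<open>S \<noteq> {}\<close> assms r by simp
  qed
  moreover have "int (bip_ex m n T) \<le> (int r - 1) * int n + C_bound m r s" if r: "2 \<le> r"
  proof (cases "r \<le> m")
    case True
    have "bip_ex m n T \<le> m * (s - 1) + (r - 1) * n + (m - (r - 1)) * ((s - 1) * (m choose (r - 1)))"
      using card_edges_free_le[OF T(1,3) ne bip assms(3,5,4)] True
      by (intro bip_ex_le[OF ne]) blast
    then have "int (bip_ex m n T) \<le> int ((r - 1) * n)
        + int (m * (s - 1) + (m - (r - 1)) * ((s - 1) * (m choose (r - 1))))"
      by linarith
    also have "\<dots> \<le> int ((r - 1) * n) + C_bound m r s"
      using C_bound_ge[OF r True] assms by simp
    finally show ?thesis using r by (simp add: of_nat_diff)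
  next
    case False
    \<comment> \<open>For \<open>m < r\<close> the trivial bound \<open>m * n\<close> is already at
      most \<open>(r - 1) * n\<close>, and it remains only that \<open>C_bound\<close> is
      nonnegative.\<close>
    have "bip_ex m n T \<le> m * n"
      using card_edges_le_mult by (intro bip_ex_le[OF ne]) blast
    also have "\<dots> \<le> (r - 1) * n" using False by (intro mult_le_mono1) simp
    finally have "int (bip_ex m n T) \<le> int ((r - 1) * n)" by (simp only: of_nat_le_iff)
    then show ?thesis
      using C_bound_nonneg[of m r s] False r assms by (simp add: of_nat_diff)
  qed
  ultimately show ?thesis by blast
qed

end
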